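(* Let $X$ be a compact complex manifold with $n=\dim_{\mathbb{C}}X$. (i) Suppose that $K_X$ is trivial and fix a non-vanishing holomorphic $(n,0)$-form $u$ on $X$. Then, for any forms $\theta_1,\theta_2\in C^\infty_{0,1}(X,T^{1,0}X)$, the following identity holds: $$[\theta_1,\theta_2]\lrcorner u=-\partial\big(\theta_1\lrcorner(\theta_2\lrcorner u)\big)+\theta_1\lrcorner\partial(\theta_2\lrcorner u)+\theta_2\lrcorner\partial(\theta_1\lrcorner u).$$ (ii) For any bidegree $(p,q)$, any form $\alpha\in C^\infty_{p,q}(X,\mathbb{C})$ and any forms $\theta_1,\theta_2\in C^\infty_{0,1}(X,T^{1,0}X)$, the following identity holds: $$[\theta_1,\theta_2]\lrcorner\alpha=-\partial\big(\theta_1\lrcorner(\theta_2\lrcorner\alpha)\big)+\theta_1\lrcorner L_{\theta_2}(\alpha)+\theta_2\lrcorner L_{\theta_1}(\alpha)+\theta_1\lrcorner(\theta_2\lrcorner\partial\alpha).$$ In particular, if $\partial\alpha=0$ and $\partial(\theta_1\lrcorner\alpha)=\partial(\theta_2\lrcorner\alpha)=0$, then $$[\theta_1,\theta_2]\lrcorner\alpha=-\partial\big(\theta_1\lrcorner(\theta_2\lrcorner\alpha)\big).$$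
   Context: $C^\infty_{p,q}(X,\mathbb{C})$ denotes smooth $(p,q)$-forms and $C^\infty_{0,s}(X,T^{1,0}X)$ smooth $(0,s)$-forms with values in the holomorphic tangent bundle. $K_X$ is the canonical bundle. Contraction: for $\theta=\sum_k\theta^k\frac{\partial}{\partial z_k}$ locally, with $(0,s)$-forms $\theta^k$, $\theta\lrcorner u:=\sum_k\theta^k\wedge\big(\frac{\partial}{\partial z_k}\lrcorner u\big)$. Lie derivative: for $\theta\in C^\infty_{0,1}(X,T^{1,0}X)$, $L_\theta u:=\partial(\theta\lrcorner u)-\theta\lrcorner\partial u$. Lie bracket: for $\theta=\sum_\lambda\theta^\lambda\frac{\partial}{\partial z_\lambda}$ and $\psi=\sum_\lambda\psi^\lambda\frac{\partial}{\partial z_\lambda}$ in $C^\infty_{0,1}(X,T^{1,0}X)$, $[\theta,\psi]:=\sum_{\lambda,\mu}\big(\theta^\mu\wedge\frac{\partial\psi^\lambda}{\partial z_\mu}+\psi^\mu\wedge\frac{\partial\theta^\lambda}{\partial z_\mu}\big)\frac{\partial}{\partial z_\lambda}\in C^\infty_{0,2}(X,T^{1,0}X)$. *)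

theory Defs
  imports "HOL-Analysis.Analysis"
begin

section \<open>The exterior algebra of complex covectors\<close>

text \<open>
  \<open>Z k\<close> stands for \<open>dz\<^sub>k\<close> and \<open>Zbar k\<close> for its complex conjugate. All the \<open>Z k\<close> precede all the
  \<open>Zbar k\<close>. The index type \<open>'n\<close> is any finite linear order; \<open>CARD('n)\<close> is the complex dimension.
\<close>

datatype 'n coord = Z 'n | Zbar 'n

instantiation coord :: (linorder) linorder
begin

fun less_eq_coord :: "'a coord \<Rightarrow> 'a coord \<Rightarrow> bool" where
  "less_eq_coord (Z i) (Z j) \<longleftrightarrow> i \<le> j"
| "less_eq_coord (Z i) (Zbar j) \<longleftrightarrow> True"
| "less_eq_coord (Zbar i) (Z j) \<longleftrightarrow> False"
| "less_eq_coord (Zbar i) (Zbar j) \<longleftrightarrow> i \<le> j"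

definition less_coord :: "'a coord \<Rightarrow> 'a coord \<Rightarrow> bool" where
  "less_coord x y \<longleftrightarrow> x \<le> y \<and> \<not> y \<le> x"

instance
proof
  fix x y z :: "'a coord"
  show "x < y \<longleftrightarrow> x \<le> y \<and> \<not> y \<le> x"
    by (rule less_coord_def)
  show "x \<le> x"
    by (cases x) auto
  show "x \<le> y \<Longrightarrow> y \<le> z \<Longrightarrow> x \<le> z"
    by (cases x; cases y; cases z) auto
  show "x \<le> y \<Longrightarrow> y \<le> x \<Longrightarrow> x = y"
    by (cases x; cases y) auto
  show "x \<le> y \<or> y \<le> x"
    by (cases x; cases y) auto
qed

end

instance coord :: (finite) finite
proof
  have "(UNIV :: 'a coord set) = range Z \<union> range Zbar"
    by (metis UNIV_eq_I UnI1 UnI2 coord.exhaust rangeI)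
  then show "finite (UNIV :: 'a coord set)"
    by (metis finite_UnI finite_imageI finite)
qed

text \<open>
  A complex exterior covector \<open>a\<close> is given by its coefficients: \<open>a $ K\<close> is the coefficient of
  the wedge product of the elements of \<open>K\<close> taken in increasing order.
\<close>

type_synonym 'n covec = "(complex, 'n coord set) vec"

text \<open>For disjoint \<open>I\<close> and \<open>J\<close>, \<open>dx\<^sub>I \<and> dx\<^sub>J\<close> is this sign times \<open>dx\<close> indexed by \<open>I \<union> J\<close>.\<close>

definition merge_sign :: "'i::linorder set \<Rightarrow> 'i set \<Rightarrow> complex" where
  "merge_sign I J = (- 1) ^ card {(i, j) \<in> I \<times> J. j < i}"

definition wedge :: "'n::{finite,linorder} covec \<Rightarrow> 'n covec \<Rightarrow> 'n covec"  (infixr "\<and>\<^sub>w" 75) where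
  "a \<and>\<^sub>w b = (\<chi> K. \<Sum>I\<in>Pow K. merge_sign I (K - I) * a $ I * b $ (K - I))"

definition basic :: "'n::{finite,linorder} coord \<Rightarrow> 'n covec" where
  "basic x = axis {x} 1"

text \<open>Interior product with \<open>\<partial>/\<partial>z\<^sub>k\<close>, i.e. the operator that sends \<open>dz\<^sub>k \<and> dx\<^sub>I\<close> to \<open>dx\<^sub>I\<close> and
  kills \<open>dx\<^sub>I\<close>, for \<open>I\<close> not containing \<open>dz\<^sub>k\<close>.\<close>

definition interior_z :: "'n::{finite,linorder} \<Rightarrow> 'n covec \<Rightarrow> 'n covec" where
  "interior_z k a = (\<chi> I. if Z k \<in> I then 0 else merge_sign {Z k} I * a $ (insert (Z k) I))"

definition has_bidegree :: "nat \<Rightarrow> nat \<Rightarrow> 'n::{finite,linorder} covec \<Rightarrow> bool" where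
  "has_bidegree p q a \<longleftrightarrow>
     (\<forall>K. a $ K \<noteq> 0 \<longrightarrow> card {k. Z k \<in> K} = p \<and> card {k. Zbar k \<in> K} = q)"


section \<open>Smooth and holomorphic functions of several complex variables\<close>

text \<open>Both notions are meant for open sets \<open>S\<close>; smoothness is in the real sense.\<close>

primrec Ck_on :: "nat \<Rightarrow> ('a::euclidean_space \<Rightarrow> 'b::real_normed_vector) \<Rightarrow> 'a set \<Rightarrow> bool" where
  "Ck_on 0 f S \<longleftrightarrow> continuous_on S f"
| "Ck_on (Suc k) f S \<longleftrightarrow>
     (\<forall>x\<in>S. f differentiable (at x)) \<and> (\<forall>v. Ck_on k (\<lambda>x. frechet_derivative f (at x) v) S)"

definition smooth_on :: "('a::euclidean_space \<Rightarrow> 'b::real_normed_vector) \<Rightarrow> 'a set \<Rightarrow> bool" where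
  "smooth_on f S \<longleftrightarrow> (\<forall>k. Ck_on k f S)"

definition holo_on :: "(complex ^ 'n \<Rightarrow> complex) \<Rightarrow> (complex ^ 'n) set \<Rightarrow> bool" where
  "holo_on f S \<longleftrightarrow>
     (\<forall>z\<in>S. \<exists>D. (f has_derivative D) (at z) \<and> (\<forall>c v. D (c *s v) = c * D v))"

text \<open>\<open>\<partial>f/\<partial>z\<^sub>k = 1/2 (\<partial>f/\<partial>x\<^sub>k - \<i> \<partial>f/\<partial>y\<^sub>k)\<close>, componentwise for vector-valued \<open>f\<close>.\<close>

definition d_dz :: "'n::finite \<Rightarrow> (complex ^ 'n \<Rightarrow> complex ^ 'm) \<Rightarrow> complex ^ 'n \<Rightarrow> complex ^ 'm" where
  "d_dz k f z = (1 / 2) *s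
     (frechet_derivative f (at z) (axis k 1) - \<i> *s frechet_derivative f (at z) (axis k \<i>))"


section \<open>Complex manifolds\<close>

text \<open>A chart is a pair of an open subset of the space and a coordinate map on it.\<close>

type_synonym ('a, 'n) chart = "'a set \<times> ('a \<Rightarrow> complex ^ 'n)"

definition chart_image :: "('a, 'n) chart \<Rightarrow> (complex ^ 'n) set" where
  "chart_image c = snd c ` fst c"

definition overlap :: "('a, 'n) chart \<Rightarrow> ('a, 'n) chart \<Rightarrow> (complex ^ 'n) set" where
  "overlap c d = snd c ` (fst c \<inter> fst d)"

definition transition :: "('a, 'n) chart \<Rightarrow> ('a, 'n) chart \<Rightarrow> complex ^ 'n \<Rightarrow> complex ^ 'n" where
  "transition c d = snd d \<circ> inv_into (fst c) (snd c)"

definition complex_manifold :: "'a topology \<Rightarrow> ('a, 'n::finite) chart set \<Rightarrow> bool" where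
  "complex_manifold X A \<longleftrightarrow>
     Hausdorff_space X \<and> second_countable X \<and>
     (\<Union>c\<in>A. fst c) = topspace X \<and>
     (\<forall>c\<in>A. openin X (fst c) \<and> open (chart_image c) \<and>
        homeomorphic_map (subtopology X (fst c)) (top_of_set (chart_image c)) (snd c)) \<and>
     (\<forall>c\<in>A. \<forall>d\<in>A. \<forall>i. holo_on (\<lambda>z. transition c d z $ i) (overlap c d))"


section \<open>Differential forms\<close>

text \<open>
  A form is given by its coordinate expressions, one for each chart of the atlas. Only the values
  on the image of the chart are meaningful. The expressions have to be related by pull-back along
  the (holomorphic) coordinate changes.
\<close>

type_synonym ('a, 'n) form = "('a, 'n) chart \<Rightarrow> complex ^ 'n \<Rightarrow> 'n covec"

text \<open>\<open>\<theta> c z $ k\<close> is the coefficient \<open>\<theta>\<^sup>k\<close> of \<open>\<partial>/\<partial>z\<^sub>k\<close> in the chart \<open>c\<close>.\<close>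

type_synonym ('a, 'n) vform = "('a, 'n) chart \<Rightarrow> complex ^ 'n \<Rightarrow> ('n covec, 'n) vec"

text \<open>The differentials at \<open>z\<close> of the components of a holomorphic map \<open>\<tau>\<close> and of their
  conjugates.\<close>

primrec d_component ::
  "((complex, 'n::{finite,linorder}) vec \<Rightarrow> (complex, 'n) vec) \<Rightarrow> (complex, 'n) vec \<Rightarrow> 'n coord \<Rightarrow> 'n covec" where
  "d_component \<tau> z (Z l) = (\<Sum>j\<in>UNIV. (d_dz j \<tau> z $ l) *s basic (Z j))"
| "d_component \<tau> z (Zbar l) = (\<Sum>j\<in>UNIV. cnj (d_dz j \<tau> z $ l) *s basic (Zbar j))"

definition pullback ::
  "((complex, 'n::{finite,linorder}) vec \<Rightarrow> (complex, 'n) vec) \<Rightarrow> (complex, 'n) vec \<Rightarrow> 'n covec \<Rightarrow> 'n covec" where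
  "pullback \<tau> z a =
     (\<Sum>K\<in>UNIV. (a $ K) *s
        foldr (\<lambda>x b. d_component \<tau> z x \<and>\<^sub>w b) (sorted_list_of_set K) (axis {} 1))"

definition smooth_forms ::
  "('a, 'n::{finite,linorder}) chart set \<Rightarrow> nat \<Rightarrow> nat \<Rightarrow> ('a, 'n) form set" where
  "smooth_forms A p q = {\<alpha>.
     (\<forall>c\<in>A. smooth_on (\<alpha> c) (chart_image c)) \<and>
     (\<forall>c\<in>A. \<forall>z\<in>chart_image c. has_bidegree p q (\<alpha> c z)) \<and>
     (\<forall>c\<in>A. \<forall>d\<in>A. \<forall>z\<in>overlap c d.
        \<alpha> c z = pullback (transition c d) z (\<alpha> d (transition c d z)))}"

text \<open>
  Forms with values in the holomorphic tangent bundle. With \<open>w = \<tau>(z)\<close> the coordinates of \<open>d\<close>,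
  \<open>\<partial>/\<partial>z\<^sub>k = \<Sum>\<^sub>l (\<partial>\<tau>\<^sub>l/\<partial>z\<^sub>k) \<partial>/\<partial>w\<^sub>l\<close>, which gives the transformation law.
\<close>

definition smooth_vforms ::
  "('a, 'n::{finite,linorder}) chart set \<Rightarrow> nat \<Rightarrow> ('a, 'n) vform set" where
  "smooth_vforms A s = {\<theta>.
     (\<forall>c\<in>A. smooth_on (\<theta> c) (chart_image c)) \<and>
     (\<forall>c\<in>A. \<forall>z\<in>chart_image c. \<forall>k. has_bidegree 0 s (\<theta> c z $ k)) \<and>
     (\<forall>c\<in>A. \<forall>d\<in>A. \<forall>z\<in>overlap c d. \<forall>l.
        pullback (transition c d) z (\<theta> d (transition c d z) $ l) =
        (\<Sum>k\<in>UNIV. (d_dz k (transition c d) z $ l) *s (\<theta> c z $ k)))}"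

definition holomorphic_forms ::
  "('a, 'n::{finite,linorder}) chart set \<Rightarrow> nat \<Rightarrow> ('a, 'n) form set" where
  "holomorphic_forms A p =
     {\<alpha> \<in> smooth_forms A p 0. \<forall>c\<in>A. \<forall>K. holo_on (\<lambda>z. \<alpha> c z $ K) (chart_image c)}"

definition nonvanishing :: "('a, 'n::{finite,linorder}) chart set \<Rightarrow> ('a, 'n) form \<Rightarrow> bool" where
  "nonvanishing A \<alpha> \<longleftrightarrow> (\<forall>c\<in>A. \<forall>z\<in>chart_image c. \<alpha> c z \<noteq> 0)"

text \<open>
  On an overlap the coefficients of an element of \<open>K\<^sub>X\<close> satisfy \<open>a\<^sub>c = det(\<partial>\<tau>\<^sub>l/\<partial>z\<^sub>k) a\<^sub>d\<close>.
  A holomorphic bundle isomorphism from \<open>K\<^sub>X\<close> to the product bundle \<open>X \<times> \<complex>\<close> is, in each chart,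
  multiplication of this coefficient by a holomorphic function \<open>h c\<close> without zeros; these have to
  be compatible, \<open>h\<^sub>c a\<^sub>c = h\<^sub>d a\<^sub>d\<close>.
\<close>

definition trivial_canonical_bundle :: "('a, 'n::finite) chart set \<Rightarrow> bool" where
  "trivial_canonical_bundle A \<longleftrightarrow>
     (\<exists>h :: ('a, 'n) chart \<Rightarrow> (complex, 'n) vec \<Rightarrow> complex.
        (\<forall>c\<in>A. holo_on (h c) (chart_image c) \<and> (\<forall>z\<in>chart_image c. h c z \<noteq> 0)) \<and>
        (\<forall>c\<in>A. \<forall>d\<in>A. \<forall>z\<in>overlap c d.
           h c z * det (\<chi> l k. d_dz k (transition c d) z $ l) = h d (transition c d z)))"


section \<open>Operators on forms\<close>

definition del :: "('a, 'n::{finite,linorder}) form \<Rightarrow> ('a, 'n) form" where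
  "del \<alpha> = (\<lambda>c z. \<Sum>m\<in>UNIV. basic (Z m) \<and>\<^sub>w d_dz m (\<alpha> c) z)"

definition contraction ::
  "('a, 'n::{finite,linorder}) vform \<Rightarrow> ('a, 'n) form \<Rightarrow> ('a, 'n) form"  (infixr "'_|" 75) where
  "\<theta> _| \<alpha> = (\<lambda>c z. \<Sum>k\<in>UNIV. (\<theta> c z $ k) \<and>\<^sub>w interior_z k (\<alpha> c z))"

definition lie_derivative ::
  "('a, 'n::{finite,linorder}) vform \<Rightarrow> ('a, 'n) form \<Rightarrow> ('a, 'n) form" where
  "lie_derivative \<theta> \<alpha> = (\<lambda>c z. del (\<theta> _| \<alpha>) c z - (\<theta> _| del \<alpha>) c z)"

definition lie_bracket ::
  "('a, 'n::{finite,linorder}) vform \<Rightarrow> ('a, 'n) vform \<Rightarrow> ('a, 'n) vform" where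
  "lie_bracket \<theta> \<psi> = (\<lambda>c z. \<chi> l. \<Sum>m\<in>UNIV.
     (\<theta> c z $ m) \<and>\<^sub>w d_dz m (\<lambda>w. \<psi> c w $ l) z +
     (\<psi> c z $ m) \<and>\<^sub>w d_dz m (\<lambda>w. \<theta> c w $ l) z)"

end

theory Submission
  imports Defs
begin

text \<open>
  All four terms are first-order in the data, so the identity can be checked at a point of a chart.
  Contraction with a \<open>T\<^sup>1\<^sup>,\<^sup>0\<close>-valued \<open>(0,1)\<close>-form has degree zero; contractions commute with each other
  and with the exterior product by a \<open>(0,1)\<close>-form, while contracting past \<open>dz\<^sub>m \<and>\<close> produces the extra
  term \<open>\<theta>\<^sup>m \<and>\<close>. Hence the right-hand side of (ii) is the commutator of contraction with \<open>\<theta>\<^sub>2\<close> and the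
  Lie derivative along \<open>\<theta>\<^sub>1\<close>, in which the derivatives of \<open>\<alpha>\<close> cancel, leaving the bracket. Part (i)
  follows because \<open>\<partial>u = 0\<close> for degree reasons.
\<close>

section \<open>Exterior algebra\<close>

lemma merge_sign_singleton:
  "merge_sign {x} I = (- 1) ^ card {j \<in> I. j < x}"
proof -
  have "{(i, j) \<in> {x} \<times> I. j < i} = Pair x ` {j \<in> I. j < x}"
    by auto
  then show ?thesis
    by (simp add: merge_sign_def card_image inj_on_def)
qed

lemma merge_sign_square [simp]: "merge_sign I J * merge_sign I J = 1"
  by (simp add: merge_sign_def flip: power_mult_distrib)

text \<open>The inversions of a disjoint union split disjointly, so the sign is multiplicative. With
  the twin rule for the second argument this makes the wedge product associative.\<close>

lemma merge_sign_Un_left: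
  fixes I J K :: "'i::{finite,linorder} set"
  assumes "I \<inter> J = {}"
  shows "merge_sign (I \<union> J) K = merge_sign I K * merge_sign J K"
proof -
  have "{(i, j) \<in> (I \<union> J) \<times> K. j < i} =
    {(i, j) \<in> I \<times> K. j < i} \<union> {(i, j) \<in> J \<times> K. j < i}"
    by auto
  moreover have "{(i, j) \<in> I \<times> K. j < i} \<inter> {(i, j) \<in> J \<times> K. j < i} = {}"
    using assms by auto
  ultimately show ?thesis
    by (simp add: merge_sign_def card_Un_disjoint power_add)
qed

lemma merge_sign_Un_right:
  fixes I J K :: "'i::{finite,linorder} set"
  assumes "J \<inter> K = {}"
  shows "merge_sign I (J \<union> K) = merge_sign I J * merge_sign I K"
proof -
  have "{(i, j) \<in> I \<times> (J \<union> K). j < i} =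
    {(i, j) \<in> I \<times> J. j < i} \<union> {(i, j) \<in> I \<times> K. j < i}"
    by auto
  moreover have "{(i, j) \<in> I \<times> J. j < i} \<inter> {(i, j) \<in> I \<times> K. j < i} = {}"
    using assms by auto
  ultimately show ?thesis
    by (simp add: merge_sign_def card_Un_disjoint power_add)
qed

lemma merge_sign_insert_right:
  fixes x :: "'i::{finite,linorder}"
  assumes "y \<notin> I"
  shows "merge_sign {x} (insert y I) = merge_sign {x} {y} * merge_sign {x} I"
  using merge_sign_Un_right[of "{y}" I "{x}"] assms by simp

text \<open>Exactly one of the pairs (x, y) and (y, x) is an inversion. All anticommutation rules
  below rest on this.\<close>

lemma merge_sign_swap:
  fixes x y :: "'i::linorder"
  assumes "x \<noteq> y"
  shows "merge_sign {x} {y} = - merge_sign {y} {x}"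
proof -
  have "card {j. j = b \<and> j < a} = (if b < a then 1 else 0)" for a b :: 'i
  proof -
    have "{j. j = b \<and> j < a} = (if b < a then {b} else {})" by auto
    then show ?thesis by simp
  qed
  with assms show ?thesis
    by (auto simp: merge_sign_singleton)
qed

section \<open>Multilinearity and reduction to monomials\<close>

lemma wedge_add_left: "(a + b) \<and>\<^sub>w c = a \<and>\<^sub>w c + b \<and>\<^sub>w c"
  by (simp add: wedge_def vec_eq_iff algebra_simps sum.distrib)

lemma wedge_add_right: "a \<and>\<^sub>w (b + c) = a \<and>\<^sub>w b + a \<and>\<^sub>w c"
  by (simp add: wedge_def vec_eq_iff algebra_simps sum.distrib)

lemma wedge_scale_left: "(x *s a) \<and>\<^sub>w b = x *s (a \<and>\<^sub>w b)"
  by (simp add: wedge_def vec_eq_iff sum_distrib_left mult_ac)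

lemma wedge_scale_right: "a \<and>\<^sub>w (x *s b) = x *s (a \<and>\<^sub>w b)"
  by (simp add: wedge_def vec_eq_iff sum_distrib_left mult_ac)

lemma scaleR_eq_scale: "r *\<^sub>R (a :: complex ^ 'm) = complex_of_real r *s a"
  by (simp add: vec_eq_iff) (simp add: scaleR_conv_of_real)

text \<open>In finite dimension bilinearity already implies boundedness. The locale supplies the
  product rule \<open>wedge.FDERIV\<close> and the rules for sums and signs.\<close>

interpretation wedge: bounded_bilinear wedge
proof -
  have "bilinear (wedge :: 'a covec \<Rightarrow> _)"
    unfolding bilinear_def
    by (auto intro!: linearI
        simp: wedge_add_left wedge_add_right scaleR_eq_scale wedge_scale_left wedge_scale_right)
  then show "bounded_bilinear (wedge :: 'a covec \<Rightarrow> _)"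
    by (simp add: bilinear_conv_bounded_bilinear)
qed

lemma interior_z_add: "interior_z k (a + b) = interior_z k a + interior_z k b"
  by (simp add: interior_z_def vec_eq_iff algebra_simps)

lemma interior_z_scale: "interior_z k (x *s a) = x *s interior_z k a"
  by (simp add: interior_z_def vec_eq_iff)

lemma bounded_linear_interior_z: "bounded_linear (interior_z k)"
  by (auto intro!: linearI
      simp: interior_z_add scaleR_eq_scale interior_z_scale simp flip: linear_conv_bounded_linear)

lemmas interior_z_zero = linear_0[OF bounded_linear.linear[OF bounded_linear_interior_z]]
lemmas interior_z_diff = linear_diff[OF bounded_linear.linear[OF bounded_linear_interior_z]]

lemma covec_expansion: "(a :: 'n::{finite,linorder} covec) = (\<Sum>K\<in>UNIV. (a $ K) *s axis K 1)"
  by (simp add: vec_eq_iff axis_def if_distrib[of "\<lambda>x. _ * x"] cong: if_cong)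

text \<open>Extension by linearity: an identity linear in a covector need only be checked on the
  monomials \<open>axis K 1\<close>.\<close>

lemma covec_induct:
  fixes a :: "'n::{finite,linorder} covec"
  assumes "\<And>K. P (axis K 1)" and "\<And>a b. P a \<Longrightarrow> P b \<Longrightarrow> P (a + b)" and "\<And>x a. P a \<Longrightarrow> P (x *s a)"
  shows "P a"
proof -
  have "P 0"
    using assms(3)[OF assms(1), of 0 "{}"] by simp
  then have "P (\<Sum>K\<in>S. (a $ K) *s axis K 1)" for S
    by (induction S rule: infinite_finite_induct) (auto intro: assms)
  then show ?thesis
    by (metis covec_expansion)
qed

lemma wedge_axis:
  "axis I 1 \<and>\<^sub>w axis J 1 = (if I \<inter> J = {} then merge_sign I J *s axis (I \<union> J) 1 else 0)"
  (is "?l = ?r")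
proof (intro vec_eq_iff[THEN iffD2] allI)
  fix K
  \<comment> \<open>Only the splitting with \<open>L = I\<close> has a nonzero first factor, and its
    complement must then be \<open>J\<close>.\<close>
  have "?l $ K = (\<Sum>L\<in>Pow K. if L = I then
      (if K - I = J then merge_sign I J else 0) else 0)"
    unfolding wedge_def vec_lambda_beta
    by (rule sum.cong) (auto simp: axis_def Int_commute)
  also have "\<dots> = (if I \<subseteq> K \<and> K - I = J then merge_sign I J else 0)"
    by (simp add: sum.delta')
  also have "I \<subseteq> K \<and> K - I = J \<longleftrightarrow> I \<inter> J = {} \<and> K = I \<union> J"
    by auto
  finally show "?l $ K = ?r $ K"
    by (auto simp: axis_def)
qed

text \<open>By trilinearity it suffices to take monomials. There both sides vanish if two index sets
  meet, and otherwise carry the product of the three pairwise signs.\<close>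

lemma wedge_assoc: "(a \<and>\<^sub>w b) \<and>\<^sub>w c = a \<and>\<^sub>w (b \<and>\<^sub>w c)"
proof (induction a rule: covec_induct)
  case (1 I)
  show ?case
  proof (induction b rule: covec_induct)
    case (1 J)
    show ?case
    proof (induction c rule: covec_induct)
      case (1 K)
      show ?case
        by (auto simp: wedge_axis wedge_scale_left wedge_scale_right vector_smult_assoc
            merge_sign_Un_left merge_sign_Un_right Un_assoc Int_Un_distrib Int_Un_distrib2
            wedge.zero_left wedge.zero_right)
    qed (simp_all add: wedge_add_right wedge_scale_right)
  qed (simp_all add: wedge_add_left wedge_scale_left wedge_add_right wedge_scale_right)
qed (simp_all add: wedge_add_left wedge_scale_left)

lemma basic_wedge_basic: "basic x \<and>\<^sub>w basic y = - (basic y \<and>\<^sub>w basic x)"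
  using merge_sign_swap[of x y]
  by (auto simp: basic_def wedge_axis insert_commute vec_eq_iff)

lemma basic_wedge_swap: "basic x \<and>\<^sub>w basic y \<and>\<^sub>w a = - (basic y \<and>\<^sub>w basic x \<and>\<^sub>w a)"
  by (metis basic_wedge_basic wedge_assoc wedge.minus_left)

section \<open>Interior products\<close>

lemma interior_z_axis:
  "interior_z k (axis I 1) =
    (if Z k \<in> I then merge_sign {Z k} (I - {Z k}) *s axis (I - {Z k}) 1 else 0)"
proof (intro vec_eq_iff[THEN iffD2] allI)
  fix K
  have "Z k \<notin> K \<and> insert (Z k) K = I \<longleftrightarrow> Z k \<in> I \<and> K = I - {Z k}"
    by auto
  then show "interior_z k (axis I 1) $ K =
    (if Z k \<in> I then merge_sign {Z k} (I - {Z k}) *s axis (I - {Z k}) 1 else 0) $ K"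
    by (auto simp: interior_z_def axis_def)
qed

text \<open>The antiderivation property for a factor of degree one, checked on monomials according
  to whether \<open>x\<close> is \<open>Z k\<close> and which of the two lie in
  \<open>I\<close>.\<close>

lemma interior_z_basic_wedge:
  "interior_z k (basic x \<and>\<^sub>w a) = (if x = Z k then a else 0) - basic x \<and>\<^sub>w interior_z k a"
proof (induction a rule: covec_induct)
  case (1 I)
  consider "x = Z k" "x \<in> I" | "x = Z k" "x \<notin> I" | "x \<noteq> Z k" "x \<in> I" | "x \<noteq> Z k" "x \<notin> I" "Z k \<notin> I"
    | "x \<noteq> Z k" "x \<notin> I" "Z k \<in> I" by blast
  then show ?case
  proof cases
    \<comment> \<open>The one case where two distinct covectors pass each other. The signs relative
      to \<open>J\<close> agree on both sides; only the order of \<open>x\<close> and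
      \<open>Z k\<close> differs, whence the minus sign.\<close>
    case 5
    define J where "J = I - {Z k}"
    have I: "I = insert (Z k) J" and J: "Z k \<notin> J" "x \<notin> J"
      using 5 by (auto simp: J_def)
    have IJ: "insert x I - {Z k} = insert x J" "I - {Z k} = J" "I \<inter> {x} = {}" "J \<inter> {x} = {}"
      using 5 J by (auto simp: J_def)
    have swap: "merge_sign {x} {Z k} * merge_sign {Z k} {x} = - 1"
      using merge_sign_swap[OF 5(1)] by simp
    have "merge_sign {x} I * merge_sign {Z k} (insert x J) =
        (merge_sign {x} {Z k} * merge_sign {Z k} {x}) * (merge_sign {Z k} J * merge_sign {x} J)"
      by (simp only: I merge_sign_insert_right[OF J(1)] merge_sign_insert_right[OF J(2)] mult_ac)
    then have sgn: "merge_sign {x} I * merge_sign {Z k} (insert x J) =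
        - (merge_sign {Z k} J * merge_sign {x} J)"
      by (simp add: swap)
    have "interior_z k (basic x \<and>\<^sub>w axis I 1) =
        (merge_sign {x} I * merge_sign {Z k} (insert x J)) *s axis (insert x J) 1"
      using 5 by (simp add: basic_def wedge_axis interior_z_axis interior_z_scale IJ
          vector_smult_assoc)
    also have "\<dots> = - (basic x \<and>\<^sub>w interior_z k (axis I 1))"
      using 5 J by (simp add: basic_def wedge_axis interior_z_axis wedge_scale_right IJ
          vector_smult_assoc sgn vector_smult_lneg)
    finally show ?thesis
      using 5 by simp
  qed (auto simp: basic_def wedge_axis interior_z_axis interior_z_scale wedge_scale_right
      vector_smult_assoc insert_absorb interior_z_zero wedge.zero_right)
next
  case (2 a b)
  then show ?case
    by (simp add: wedge_add_right interior_z_add)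
next
  case (3 x a)
  then show ?case
    by (simp add: wedge_scale_right interior_z_scale vector_ssub_ldistrib)
qed

text \<open>For distinct \<open>k\<close> and \<open>l\<close>, with neither covector in
  \<open>I\<close>, both coefficients come from the same entry of \<open>a\<close>, with signs
  differing by a swap. In all other cases both vanish.\<close>

lemma interior_z_swap: "interior_z k (interior_z l a) = - interior_z l (interior_z k a)"
proof (intro vec_eq_iff[THEN iffD2] allI)
  fix I
  show "interior_z k (interior_z l a) $ I = (- interior_z l (interior_z k a)) $ I"
    using merge_sign_swap[of "Z k" "Z l"] merge_sign_insert_right[of "Z k" I "Z l"]
      merge_sign_insert_right[of "Z l" I "Z k"]
    by (auto simp: interior_z_def insert_commute)
qed

section \<open>Covectors of bidegree (0,1)\<close>

lemma has_bidegree_0_1_expansion: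
  assumes "has_bidegree 0 1 a"
  shows "a = (\<Sum>j\<in>UNIV. (a $ {Zbar j}) *s basic (Zbar j))"
proof (intro vec_eq_iff[THEN iffD2] allI)
  fix K
  \<comment> \<open>With no \<open>Z k\<close> and a single \<open>Zbar j\<close>, the index set of
    a surviving monomial is a singleton.\<close>
  have sing: "\<exists>j. K = {Zbar j}" if "a $ K \<noteq> 0"
  proof -
    have "{k. Z k \<in> K} = {}" "card {k. Zbar k \<in> K} = 1"
      using assms that by (auto simp: has_bidegree_def)
    then obtain j where "{k. Zbar k \<in> K} = {j}" "{k. Z k \<in> K} = {}"
      by (auto simp: card_1_singleton_iff)
    then have "x \<in> K \<longleftrightarrow> x = Zbar j" for x
      by (cases x) auto
    then show ?thesis by blast
  qed
  have rhs: "(\<Sum>j\<in>UNIV. (a $ {Zbar j}) *s basic (Zbar j)) $ K =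
      (\<Sum>j\<in>UNIV. if K = {Zbar j} then a $ K else 0)"
    by (auto simp: basic_def axis_def intro!: sum.cong)
  show "a $ K = (\<Sum>j\<in>UNIV. (a $ {Zbar j}) *s basic (Zbar j)) $ K"
  proof (cases "a $ K = 0")
    case False
    with sing obtain j where "K = {Zbar j}" by blast
    then show ?thesis
      unfolding rhs by simp
  next
    case True
    then show ?thesis
      unfolding rhs by (simp only: True if_cancel sum.neutral_const)
  qed
qed

text \<open>Reduces sign rules for (0,1)-covectors to those for the generators
  \<open>basic (Zbar j)\<close>.\<close>

lemma has_bidegree_0_1_induct [consumes 1, case_names basic add scale]:
  assumes "has_bidegree 0 1 a"
    and basic: "\<And>j. P (basic (Zbar j))" and add: "\<And>a b. P a \<Longrightarrow> P b \<Longrightarrow> P (a + b)"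
    and scale: "\<And>x a. P a \<Longrightarrow> P (x *s a)"
  shows "P a"
proof -
  have "P 0"
    using scale[OF basic, of 0] by simp
  then have "P (\<Sum>j\<in>S. (a $ {Zbar j}) *s basic (Zbar j))" for S
    by (induction S rule: infinite_finite_induct) (auto intro: add scale basic)
  then show ?thesis
    using has_bidegree_0_1_expansion[OF assms(1)] by metis
qed

lemma has_bidegree_0_1_wedge_basic:
  assumes "has_bidegree 0 1 a"
  shows "a \<and>\<^sub>w basic x \<and>\<^sub>w c = - (basic x \<and>\<^sub>w a \<and>\<^sub>w c)"
  using assms
  by (induction rule: has_bidegree_0_1_induct)
    (auto simp: basic_wedge_swap[of x] wedge_add_left wedge_add_right wedge_scale_left
      wedge_scale_right vec_eq_iff)

lemma has_bidegree_0_1_wedge_swap: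
  assumes "has_bidegree 0 1 a" and "has_bidegree 0 1 b"
  shows "a \<and>\<^sub>w b \<and>\<^sub>w c = - (b \<and>\<^sub>w a \<and>\<^sub>w c)"
  using assms(2)
  by (induction rule: has_bidegree_0_1_induct)
    (auto simp: has_bidegree_0_1_wedge_basic[OF assms(1)] wedge_add_left wedge_add_right
      wedge_scale_left wedge_scale_right vec_eq_iff)

text \<open>No \<open>basic (Zbar j)\<close> pairs with \<open>Z k\<close>, so only the sign term of
  \<open>interior_z_basic_wedge\<close> remains.\<close>

lemma interior_z_has_bidegree_0_1_wedge:
  assumes "has_bidegree 0 1 a"
  shows "interior_z k (a \<and>\<^sub>w b) = - (a \<and>\<^sub>w interior_z k b)"
  using assms
  by (induction rule: has_bidegree_0_1_induct)
    (auto simp: interior_z_basic_wedge wedge_add_left wedge_scale_left interior_z_add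
      interior_z_scale vec_eq_iff)

text \<open>The value of \<open>_|\<close> at one point of a chart, so that the algebra is separated
  from charts and derivatives.\<close>

definition contract :: "('n::{finite,linorder} covec, 'n) vec \<Rightarrow> 'n covec \<Rightarrow> 'n covec" where
  "contract P a = (\<Sum>k\<in>UNIV. (P $ k) \<and>\<^sub>w interior_z k a)"

lemma contract_add: "contract P (a + b) = contract P a + contract P b"
  by (simp add: contract_def wedge.add_right interior_z_add sum.distrib)

lemma contract_diff: "contract P (a - b) = contract P a - contract P b"
  by (simp add: contract_def wedge.diff_right interior_z_diff sum_subtractf)

lemma contract_zero [simp]: "contract P 0 = 0"
  by (simp add: contract_def wedge.zero_right interior_z_zero)

lemma contract_sum: "contract P (\<Sum>i\<in>S. f i) = (\<Sum>i\<in>S. contract P (f i))"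
  by (induction S rule: infinite_finite_induct) (simp_all add: contract_add)

text \<open>Passing \<open>basic (Z m)\<close> costs one sign against \<open>interior_z k\<close>
  and another against \<open>P $ k\<close>, and these cancel. The extra term is the pairing of
  \<open>interior_z m\<close> with \<open>basic (Z m)\<close>.\<close>

lemma contract_basic_wedge:
  assumes "\<And>k. has_bidegree 0 1 (P $ k)"
  shows "contract P (basic (Z m) \<and>\<^sub>w a) = (P $ m) \<and>\<^sub>w a + basic (Z m) \<and>\<^sub>w contract P a"
proof -
  have "(P $ k) \<and>\<^sub>w interior_z k (basic (Z m) \<and>\<^sub>w a) =
      (if m = k then (P $ k) \<and>\<^sub>w a else 0) + basic (Z m) \<and>\<^sub>w (P $ k) \<and>\<^sub>w interior_z k a" for k
    by (simp add: interior_z_basic_wedge wedge.diff_right wedge.minus_right wedge.zero_right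
        has_bidegree_0_1_wedge_basic[OF assms])
  then show ?thesis
    by (simp add: contract_def sum.distrib wedge.sum_right)
qed

lemma contract_has_bidegree_0_1_wedge:
  assumes "\<And>k. has_bidegree 0 1 (P $ k)" and "has_bidegree 0 1 b"
  shows "contract P (b \<and>\<^sub>w a) = b \<and>\<^sub>w contract P a"
  by (simp add: contract_def wedge.sum_right interior_z_has_bidegree_0_1_wedge[OF assms(2)]
      wedge.minus_right has_bidegree_0_1_wedge_swap[OF assms(1) assms(2)] del: One_nat_def)

text \<open>The two interior products anticommute and so do the two (0,1)-factors; the two signs
  cancel.\<close>

lemma contract_commute:
  assumes P: "\<And>k. has_bidegree 0 1 (P $ k)" and Q: "\<And>k. has_bidegree 0 1 (Q $ k)"
  shows "contract P (contract Q a) = contract Q (contract P a)"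
proof -
  have "contract P (contract Q a) =
      (\<Sum>l\<in>UNIV. \<Sum>k\<in>UNIV. (Q $ l) \<and>\<^sub>w (P $ k) \<and>\<^sub>w interior_z k (interior_z l a))"
    by (simp add: contract_def[of Q] contract_sum contract_has_bidegree_0_1_wedge P Q
        del: One_nat_def) (simp add: contract_def wedge.sum_right)
  also have "\<dots> = (\<Sum>l\<in>UNIV. \<Sum>k\<in>UNIV. (P $ k) \<and>\<^sub>w (Q $ l) \<and>\<^sub>w interior_z l (interior_z k a))"
    by (subst interior_z_swap)
      (simp add: wedge.minus_right has_bidegree_0_1_wedge_swap[OF Q P])
  also have "\<dots> = contract Q (contract P a)"
    by (subst sum.swap)
      (simp add: contract_def[of P] contract_sum contract_has_bidegree_0_1_wedge P Q
        del: One_nat_def, simp add: contract_def wedge.sum_right)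
  finally show ?thesis .
qed

text \<open>
  \<open>P' m\<close>, \<open>Q' m\<close> and \<open>a' m\<close> stand for the derivatives in direction \<open>z\<^sub>m\<close>; the terms with \<open>a'\<close> cancel.
\<close>

lemma bracket_identity:
  assumes P: "\<And>k. has_bidegree 0 1 (P $ k)" and Q: "\<And>k. has_bidegree 0 1 (Q $ k)"
    and P': "\<And>m k. has_bidegree 0 1 (P' m $ k)"
  shows "(\<Sum>m\<in>UNIV. (P $ m) \<and>\<^sub>w contract (Q' m) a + (Q $ m) \<and>\<^sub>w contract (P' m) a) =
    - (\<Sum>m\<in>UNIV. basic (Z m) \<and>\<^sub>w (contract (P' m) (contract Q a)
        + contract P (contract (Q' m) a + contract Q (a' m))))
    + contract P ((\<Sum>m\<in>UNIV. basic (Z m) \<and>\<^sub>w (contract (Q' m) a + contract Q (a' m)))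
        - contract Q (\<Sum>m\<in>UNIV. basic (Z m) \<and>\<^sub>w a' m))
    + contract Q ((\<Sum>m\<in>UNIV. basic (Z m) \<and>\<^sub>w (contract (P' m) a + contract P (a' m)))
        - contract P (\<Sum>m\<in>UNIV. basic (Z m) \<and>\<^sub>w a' m))
    + contract P (contract Q (\<Sum>m\<in>UNIV. basic (Z m) \<and>\<^sub>w a' m))"
proof -
  have contract_del: "contract R (\<Sum>m\<in>UNIV. basic (Z m) \<and>\<^sub>w x m) =
      (\<Sum>m\<in>UNIV. (R $ m) \<and>\<^sub>w x m) + (\<Sum>m\<in>UNIV. basic (Z m) \<and>\<^sub>w contract R (x m))"
    if "\<And>k. has_bidegree 0 1 (R $ k)" for R x
    by (simp only: contract_sum contract_basic_wedge[OF that] sum.distrib)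
  have contract_wedge: "contract Q (\<Sum>m\<in>UNIV. (P $ m) \<and>\<^sub>w x m) =
      (\<Sum>m\<in>UNIV. (P $ m) \<and>\<^sub>w contract Q (x m))" for x
    by (simp only: contract_sum contract_has_bidegree_0_1_wedge[OF Q P])
  \<comment> \<open>Contractions with \<open>Q\<close> are moved outermost, so that matching terms
    become literally equal.\<close>
  have commute: "contract P (contract Q x) = contract Q (contract P x)"
    "contract (P' m) (contract Q x) = contract Q (contract (P' m) x)" for x m
    by (rule contract_commute[OF P Q], rule contract_commute[OF P' Q])
  \<comment> \<open>In this normal form every term led by \<open>basic (Z m)\<close> cancels, and
    the remaining terms led by \<open>P $ m\<close> and \<open>Q $ m\<close> carry the derivatives
    \<open>Q' m\<close> and \<open>P' m\<close>.\<close>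
  show ?thesis
    unfolding contract_diff contract_add wedge.add_right sum.distrib commute
      contract_del[OF P] contract_del[OF Q] contract_wedge
    by simp
qed


section \<open>Derivatives\<close>

lemma frechet_derivative_compose_bounded_linear:
  assumes "bounded_linear h" and "f differentiable (at z)"
  shows "frechet_derivative (\<lambda>w. h (f w)) (at z) = (\<lambda>v. h (frechet_derivative f (at z) v))"
  by (rule frechet_derivative_at[symmetric])
    (rule bounded_linear.has_derivative[OF assms(1) frechet_derivative_works[THEN iffD1, OF assms(2)]])

lemma differentiable_compose_bounded_linear:
  assumes "bounded_linear h" and "f differentiable (at z)"
  shows "(\<lambda>w. h (f w)) differentiable (at z)"
  using bounded_linear.has_derivative[OF assms(1) frechet_derivative_works[THEN iffD1, OF assms(2)]]
  by (auto simp: differentiable_def)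

lemma d_dz_interior_z:
  assumes "f differentiable (at z)"
  shows "d_dz m (\<lambda>w. interior_z k (f w)) z = interior_z k (d_dz m f z)"
  by (simp add: d_dz_def interior_z_scale interior_z_diff
      frechet_derivative_compose_bounded_linear[OF bounded_linear_interior_z assms])

text \<open>No sign appears, since \<open>d_dz\<close> differentiates coefficients and does not
  multiply by \<open>basic (Z m)\<close>.\<close>

lemma d_dz_wedge:
  assumes "f differentiable (at z)" and "g differentiable (at z)"
  shows "d_dz m (\<lambda>w. f w \<and>\<^sub>w g w) z = d_dz m f z \<and>\<^sub>w g z + f z \<and>\<^sub>w d_dz m g z"
proof -
  have "frechet_derivative (\<lambda>w. f w \<and>\<^sub>w g w) (at z) = (\<lambda>h. f z \<and>\<^sub>w frechet_derivative g (at z) h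
      + frechet_derivative f (at z) h \<and>\<^sub>w g z)"
    by (rule frechet_derivative_at[OF wedge.FDERIV[OF assms[unfolded frechet_derivative_works]],
          symmetric])
  then show ?thesis
    unfolding d_dz_def wedge_scale_left wedge_scale_right wedge.diff_left wedge.diff_right
    by (simp only: vector_add_ldistrib vector_ssub_ldistrib add_diff_add add.commute)
qed

lemma d_dz_sum:
  assumes "finite S" and "\<And>i. i \<in> S \<Longrightarrow> f i differentiable (at z)"
  shows "d_dz m (\<lambda>w. \<Sum>i\<in>S. f i w) z = (\<Sum>i\<in>S. d_dz m (f i) z)"
proof -
  have "frechet_derivative (\<lambda>w. \<Sum>i\<in>S. f i w) (at z) =
      (\<lambda>h. \<Sum>i\<in>S. frechet_derivative (f i) (at z) h)"
    by (rule frechet_derivative_at[symmetric], rule has_derivative_sum)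
      (use assms in \<open>simp add: frechet_derivative_works\<close>)
  then show ?thesis
    by (simp add: d_dz_def vec_eq_iff sum_subtractf sum_distrib_left right_diff_distrib)
qed

lemma differentiable_wedge:
  assumes "f differentiable (at z)" and "g differentiable (at z)"
  shows "(\<lambda>w. f w \<and>\<^sub>w g w) differentiable (at z)"
  using wedge.FDERIV[OF assms[unfolded frechet_derivative_works]] by (auto simp: differentiable_def)

lemma differentiable_contract_term:
  assumes "T differentiable (at z)" and "f differentiable (at z)"
  shows "(\<lambda>w. (T w $ k) \<and>\<^sub>w interior_z k (f w)) differentiable (at z)"
  by (intro differentiable_wedge differentiable_compose_bounded_linear[OF bounded_linear_vec_nth]
      differentiable_compose_bounded_linear[OF bounded_linear_interior_z] assms)

lemma differentiable_contract:
  assumes "T differentiable (at z)" and "f differentiable (at z)"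
  shows "(\<lambda>w. contract (T w) (f w)) differentiable (at z)"
  unfolding contract_def
  by (intro differentiable_sum ballI differentiable_contract_term assms finite)

text \<open>Leibniz rule for a bilinear expression. The vector of componentwise derivatives is what
  \<open>P'\<close> and \<open>Q'\<close> stand for in \<open>bracket_identity\<close>.\<close>

lemma d_dz_contract:
  assumes "T differentiable (at z)" and "f differentiable (at z)"
  shows "d_dz m (\<lambda>w. contract (T w) (f w)) z =
    contract (\<chi> k. d_dz m (\<lambda>w. T w $ k) z) (f z) + contract (T z) (d_dz m f z)"
proof -
  have T: "(\<lambda>w. T w $ k) differentiable (at z)" for k
    by (rule differentiable_compose_bounded_linear[OF bounded_linear_vec_nth assms(1)])
  have f: "(\<lambda>w. interior_z k (f w)) differentiable (at z)" for k
    by (rule differentiable_compose_bounded_linear[OF bounded_linear_interior_z assms(2)])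
  show ?thesis
    unfolding contract_def
    by (simp add: d_dz_sum differentiable_contract_term assms d_dz_wedge[OF T f]
        d_dz_interior_z sum.distrib)
qed

text \<open>A coefficient outside bidegree (p,q) vanishes on the whole neighbourhood
  \<open>S\<close> of \<open>z\<close>, hence its derivative vanishes at \<open>z\<close>.\<close>

lemma has_bidegree_d_dz:
  assumes S: "open S" "z \<in> S" and f: "f differentiable (at z)"
    and bd: "\<And>w. w \<in> S \<Longrightarrow> has_bidegree p q (f w)"
  shows "has_bidegree p q (d_dz m f z)"
  unfolding has_bidegree_def
proof (intro allI impI, rule ccontr)
  fix K
  assume nz: "d_dz m f z $ K \<noteq> 0"
    and K: "\<not> (card {k. Z k \<in> K} = p \<and> card {k. Zbar k \<in> K} = q)"
  have zero: "f w $ K = 0" if "w \<in> S" for w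
    using bd[OF that] K by (auto simp: has_bidegree_def)
  have "((\<lambda>w. f w $ K) has_derivative (\<lambda>_. 0)) (at z)"
    by (rule has_derivative_transform_within_open[OF has_derivative_const S]) (simp add: zero)
  then have "frechet_derivative (\<lambda>w. f w $ K) (at z) = (\<lambda>_. 0)"
    by (metis frechet_derivative_at)
  then have "frechet_derivative f (at z) v $ K = 0" for v
    using frechet_derivative_compose_bounded_linear[OF bounded_linear_vec_nth f, of K]
    by metis
  then show False
    using nz by (simp add: d_dz_def)
qed

text \<open>Every monomial occurring in \<open>a\<close> already contains all the
  \<open>Z k\<close>, so \<open>Z m\<close> is repeated.\<close>

lemma basic_Z_wedge_top_degree:
  fixes a :: "'n::{finite,linorder} covec"
  assumes "has_bidegree CARD('n) q a"
  shows "basic (Z m) \<and>\<^sub>w a = 0"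
proof -
  have "(a $ K) *s (basic (Z m) \<and>\<^sub>w axis K 1) = 0" for K
  proof (cases "a $ K = 0")
    case False
    then have "card {k. Z k \<in> K} = CARD('n)"
      using assms by (auto simp: has_bidegree_def)
    then have "{k. Z k \<in> K} = UNIV"
      by (intro card_subset_eq) auto
    then have "Z m \<in> K" by auto
    then show ?thesis
      by (simp add: basic_def wedge_axis)
  qed simp
  then have "(\<Sum>K\<in>UNIV. (a $ K) *s (basic (Z m) \<and>\<^sub>w axis K 1)) = 0"
    by (simp only: sum.neutral_const)
  then show ?thesis
    by (subst covec_expansion[of a]) (simp only: wedge.sum_right wedge_scale_right)
qed

lemma smooth_on_differentiable:
  assumes "smooth_on f S" and "z \<in> S"
  shows "f differentiable (at z)"
proof -
  have "Ck_on (Suc 0) f S"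
    using assms(1) unfolding smooth_on_def by blast
  with assms(2) show ?thesis by simp
qed


section \<open>Forms\<close>

lemma contraction_eq: "\<theta> _| \<alpha> = (\<lambda>c z. contract (\<theta> c z) (\<alpha> c z))"
  by (simp add: contraction_def contract_def)

text \<open>With the direction \<open>m\<close> of differentiation as outer index, the inner sum is
  again a contraction, now with a vector of derivatives. This is the left-hand side of
  \<open>bracket_identity\<close>.\<close>

lemma contract_lie_bracket:
  "contract (lie_bracket \<theta> \<psi> c z) a =
    (\<Sum>m\<in>UNIV. (\<theta> c z $ m) \<and>\<^sub>w contract (\<chi> k. d_dz m (\<lambda>w. \<psi> c w $ k) z) a
      + (\<psi> c z $ m) \<and>\<^sub>w contract (\<chi> k. d_dz m (\<lambda>w. \<theta> c w $ k) z) a)"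
proof -
  have "contract (lie_bracket \<theta> \<psi> c z) a =
    (\<Sum>k\<in>UNIV. \<Sum>m\<in>UNIV. (\<theta> c z $ m) \<and>\<^sub>w d_dz m (\<lambda>w. \<psi> c w $ k) z \<and>\<^sub>w interior_z k a
      + (\<psi> c z $ m) \<and>\<^sub>w d_dz m (\<lambda>w. \<theta> c w $ k) z \<and>\<^sub>w interior_z k a)"
    by (simp add: contract_def lie_bracket_def wedge.sum_left wedge.add_left wedge_assoc)
  then show ?thesis
    by (subst (asm) sum.swap) (simp add: contract_def wedge.sum_right sum.distrib)
qed

lemma lie_bracket_contraction:
  assumes "open (chart_image c)" and "c \<in> A" and z: "z \<in> chart_image c"
    and \<alpha>: "\<alpha> \<in> smooth_forms A p q"
    and \<theta>\<^sub>1: "\<theta>\<^sub>1 \<in> smooth_vforms A 1" and \<theta>\<^sub>2: "\<theta>\<^sub>2 \<in> smooth_vforms A 1"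
  shows "(lie_bracket \<theta>\<^sub>1 \<theta>\<^sub>2 _| \<alpha>) c z =
    - del (\<theta>\<^sub>1 _| \<theta>\<^sub>2 _| \<alpha>) c z
    + (\<theta>\<^sub>1 _| lie_derivative \<theta>\<^sub>2 \<alpha>) c z
    + (\<theta>\<^sub>2 _| lie_derivative \<theta>\<^sub>1 \<alpha>) c z
    + (\<theta>\<^sub>1 _| \<theta>\<^sub>2 _| del \<alpha>) c z"
proof -
  have d\<alpha>: "\<alpha> c differentiable (at z)"
    using \<alpha> \<open>c \<in> A\<close> z by (auto simp: smooth_forms_def intro: smooth_on_differentiable)
  have d: "\<theta> c differentiable (at z)" and b: "has_bidegree 0 1 (\<theta> c z $ k)"
    and b': "has_bidegree 0 1 (d_dz m (\<lambda>w. \<theta> c w $ k) z)"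
    if "\<theta> \<in> smooth_vforms A 1" for \<theta> k m
  proof -
    show *: "\<theta> c differentiable (at z)"
      using that \<open>c \<in> A\<close> z by (auto simp: smooth_vforms_def intro: smooth_on_differentiable)
    have bd: "has_bidegree 0 1 (\<theta> c w $ k)" if "w \<in> chart_image c" for w
      using \<open>\<theta> \<in> _\<close> \<open>c \<in> A\<close> that by (auto simp: smooth_vforms_def)
    show "has_bidegree 0 1 (\<theta> c z $ k)"
      by (rule bd[OF z])
    show "has_bidegree 0 1 (d_dz m (\<lambda>w. \<theta> c w $ k) z)"
      by (rule has_bidegree_d_dz[OF assms(1) z _ bd])
        (rule differentiable_compose_bounded_linear[OF bounded_linear_vec_nth *])
  qed
  let ?d = "\<lambda>\<theta> m. \<chi> k. d_dz m (\<lambda>w. \<theta> c w $ k) z"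
  have d_contract: "d_dz m (\<lambda>w. contract (\<theta> c w) (f w)) z =
      contract (?d \<theta> m) (f z) + contract (\<theta> c z) (d_dz m f z)"
    if "\<theta> \<in> smooth_vforms A 1" "f differentiable (at z)" for \<theta> f m
    by (rule d_dz_contract[OF d[OF that(1)] that(2)])
  \<comment> \<open>In \<open>bracket_identity\<close>, contraction with the derivative of
    \<open>\<theta>\<^sub>1\<close> has to commute with contraction with
    \<open>\<theta>\<^sub>2\<close>.\<close>
  have P': "has_bidegree 0 1 (?d \<theta>\<^sub>1 m $ k)" for m k
    unfolding vec_lambda_beta by (rule b'[OF \<theta>\<^sub>1])
  \<comment> \<open>The derivative of the double contraction takes two Leibniz steps, an outer one
    for \<open>\<theta>\<^sub>1\<close> and an inner one for
    \<open>\<theta>\<^sub>2\<close>.\<close>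
  show ?thesis
    unfolding contraction_eq lie_derivative_def del_def contract_lie_bracket
      d_contract[OF \<theta>\<^sub>1 d\<alpha>] d_contract[OF \<theta>\<^sub>2 d\<alpha>]
      d_contract[OF \<theta>\<^sub>1 differentiable_contract[OF d[OF \<theta>\<^sub>2] d\<alpha>]]
    by (rule bracket_identity[OF b[OF \<theta>\<^sub>1] b[OF \<theta>\<^sub>2] P'])
qed

text \<open>Differentiation keeps the top holomorphic degree, and one more factor
  \<open>basic (Z m)\<close> then gives zero.\<close>

lemma del_top_degree:
  fixes A :: "('a, 'n::{finite,linorder}) chart set"
  assumes "open (chart_image c)" and "c \<in> A" and "z \<in> chart_image c"
    and "u \<in> smooth_forms A CARD('n) q"
  shows "del u c z = 0"
proof -
  have "has_bidegree CARD('n) q (d_dz m (u c) z)" for m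
    using assms
    by (intro has_bidegree_d_dz[OF assms(1,3)])
      (auto simp: smooth_forms_def intro: smooth_on_differentiable)
  then show ?thesis
    by (simp add: del_def basic_Z_wedge_top_degree[where q = q])
qed

theorem lemma4p11:
  fixes X :: "'a topology" and A :: "('a, 'n::{finite,linorder}) chart set"
  assumes "complex_manifold X A" and "compact_space X"
  shows
    "(trivial_canonical_bundle A \<longrightarrow>
       (\<forall>u\<in>holomorphic_forms A CARD('n). nonvanishing A u \<longrightarrow>
         (\<forall>\<theta>\<^sub>1\<in>smooth_vforms A 1. \<forall>\<theta>\<^sub>2\<in>smooth_vforms A 1. \<forall>c\<in>A. \<forall>z\<in>chart_image c.
            (lie_bracket \<theta>\<^sub>1 \<theta>\<^sub>2 _| u) c z =
              - del (\<theta>\<^sub>1 _| \<theta>\<^sub>2 _| u) c z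
              + (\<theta>\<^sub>1 _| del (\<theta>\<^sub>2 _| u)) c z
              + (\<theta>\<^sub>2 _| del (\<theta>\<^sub>1 _| u)) c z)))
     \<and>
     (\<forall>p q. \<forall>\<alpha>\<in>smooth_forms A p q.
       \<forall>\<theta>\<^sub>1\<in>smooth_vforms A 1. \<forall>\<theta>\<^sub>2\<in>smooth_vforms A 1.
         (\<forall>c\<in>A. \<forall>z\<in>chart_image c.
            (lie_bracket \<theta>\<^sub>1 \<theta>\<^sub>2 _| \<alpha>) c z =
              - del (\<theta>\<^sub>1 _| \<theta>\<^sub>2 _| \<alpha>) c z
              + (\<theta>\<^sub>1 _| lie_derivative \<theta>\<^sub>2 \<alpha>) c z
              + (\<theta>\<^sub>2 _| lie_derivative \<theta>\<^sub>1 \<alpha>) c z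
              + (\<theta>\<^sub>1 _| \<theta>\<^sub>2 _| del \<alpha>) c z) \<and>
         ((\<forall>c\<in>A. \<forall>z\<in>chart_image c.
             del \<alpha> c z = 0 \<and> del (\<theta>\<^sub>1 _| \<alpha>) c z = 0 \<and> del (\<theta>\<^sub>2 _| \<alpha>) c z = 0) \<longrightarrow>
          (\<forall>c\<in>A. \<forall>z\<in>chart_image c.
             (lie_bracket \<theta>\<^sub>1 \<theta>\<^sub>2 _| \<alpha>) c z = - del (\<theta>\<^sub>1 _| \<theta>\<^sub>2 _| \<alpha>) c z)))"
proof -
  have op: "open (chart_image c)" if "c \<in> A" for c
    using assms(1) that by (auto simp: complex_manifold_def)
  show ?thesis
  proof (intro conjI impI allI ballI)
    fix u \<theta>\<^sub>1 \<theta>\<^sub>2 c z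
    assume u: "u \<in> holomorphic_forms A CARD('n)" and \<theta>: "\<theta>\<^sub>1 \<in> smooth_vforms A 1" "\<theta>\<^sub>2 \<in> smooth_vforms A 1"
      and c: "c \<in> A" and z: "z \<in> chart_image c"
    have u': "u \<in> smooth_forms A CARD('n) 0"
      using u by (simp add: holomorphic_forms_def)
    \<comment> \<open>Case p = n, q = 0 of (ii). Contraction acts pointwise, so
      \<open>del u c z = 0\<close> kills the last term and reduces each Lie derivative at
      \<open>z\<close> to \<open>del\<close> of the contraction.\<close>
    show "(lie_bracket \<theta>\<^sub>1 \<theta>\<^sub>2 _| u) c z = - del (\<theta>\<^sub>1 _| \<theta>\<^sub>2 _| u) c z
        + (\<theta>\<^sub>1 _| del (\<theta>\<^sub>2 _| u)) c z + (\<theta>\<^sub>2 _| del (\<theta>\<^sub>1 _| u)) c z"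
      using lie_bracket_contraction[OF op[OF c] c z u' \<theta>] del_top_degree[OF op[OF c] c z u']
      by (simp add: lie_derivative_def contraction_eq)
  next
    fix p q \<alpha> \<theta>\<^sub>1 \<theta>\<^sub>2 c z
    assume "\<alpha> \<in> smooth_forms A p q" "\<theta>\<^sub>1 \<in> smooth_vforms A 1" "\<theta>\<^sub>2 \<in> smooth_vforms A 1"
      and "c \<in> A" "z \<in> chart_image c"
    then show "(lie_bracket \<theta>\<^sub>1 \<theta>\<^sub>2 _| \<alpha>) c z = - del (\<theta>\<^sub>1 _| \<theta>\<^sub>2 _| \<alpha>) c z
        + (\<theta>\<^sub>1 _| lie_derivative \<theta>\<^sub>2 \<alpha>) c z + (\<theta>\<^sub>2 _| lie_derivative \<theta>\<^sub>1 \<alpha>) c z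
        + (\<theta>\<^sub>1 _| \<theta>\<^sub>2 _| del \<alpha>) c z"
      by (intro lie_bracket_contraction op)
  next
    fix p q \<alpha> \<theta>\<^sub>1 \<theta>\<^sub>2 c z
    assume \<alpha>: "\<alpha> \<in> smooth_forms A p q"
      and \<theta>: "\<theta>\<^sub>1 \<in> smooth_vforms A 1" "\<theta>\<^sub>2 \<in> smooth_vforms A 1"
      and closed: "\<forall>c\<in>A. \<forall>z\<in>chart_image c.
        del \<alpha> c z = 0 \<and> del (\<theta>\<^sub>1 _| \<alpha>) c z = 0 \<and> del (\<theta>\<^sub>2 _| \<alpha>) c z = 0"
      and c: "c \<in> A" and z: "z \<in> chart_image c"
    \<comment> \<open>By \<open>closed\<close>, both Lie derivatives and \<open>del \<alpha>\<close>
      vanish at \<open>z\<close>, so only the first term of the general identity survives.\<close>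
    show "(lie_bracket \<theta>\<^sub>1 \<theta>\<^sub>2 _| \<alpha>) c z = - del (\<theta>\<^sub>1 _| \<theta>\<^sub>2 _| \<alpha>) c z"
      using lie_bracket_contraction[OF op[OF c] c z \<alpha> \<theta>] bspec[OF bspec[OF closed c] z]
      by (simp add: lie_derivative_def contraction_eq)
  qed
qed

end
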